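(* Let $X$ be an infinite-dimensional real Banach space and let $n\ge2$. Then $\mathcal{P}(^nX;\mathbb{R})$ fails the $w^*$-KK.
   Context: $\mathcal{P}(^nX;\mathbb{R})$ is the Banach space of continuous real-valued $n$-homogeneous polynomials on $X$ (maps $P(x)=\check P(x,\dots,x)$ with $\check P$ a continuous symmetric $n$-linear form), with norm $\|P\|=\sup_{x\in B_X}|P(x)|$. It is isometrically the dual of the completed symmetric projective tensor product $\widetilde\otimes_{\pi_s}^{n,s}X$ (the completion of the span of $\{x^{\otimes n}:x\in X\}$ under $\pi_s(u)=\inf\{\sum_j|\lambda_j|\|x_j\|^n:u=\sum_j\lambda_jx_j^{\otimes n}\}$), via $\langle P,x^{\otimes n}\rangle=P(x)$, and carries the corresponding weak-star topology (on bounded nets: pointwise convergence). A dual space $E^*$ with fixed predual $E$ has the $w^*$-KK (weak-star Kadec--Klee property) if, whenever $(x^*_\alpha)\subseteq S_{E^*}$ is a net, $x^*\in S_{E^*}$ and $x^*_\alpha\to x^*$ weak-star, then $\|x^*_\alpha-x^*\|\to0$. *)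

theory Defs
  imports "HOL-Analysis.Analysis"
begin

section \<open>Homogeneous polynomials\<close>

text \<open>\<open>X\<^sup>n\<close> is the set of extensional families \<^term>\<open>{..<n} \<rightarrow>\<^sub>E (UNIV :: 'a set)\<close>; an
  \<open>n\<close>-linear form is a function on families of which only the values on \<open>X\<^sup>n\<close> matter.\<close>

definition n_linear :: "nat \<Rightarrow> ((nat \<Rightarrow> 'a::real_vector) \<Rightarrow> real) \<Rightarrow> bool" where
  "n_linear n M \<longleftrightarrow>
     (\<forall>x \<in> {..<n} \<rightarrow>\<^sub>E UNIV. \<forall>i<n. linear (\<lambda>t. M (x(i := t))))"

definition n_symmetric :: "nat \<Rightarrow> ((nat \<Rightarrow> 'a) \<Rightarrow> real) \<Rightarrow> bool" where
  "n_symmetric n M \<longleftrightarrow>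
     (\<forall>x \<in> {..<n} \<rightarrow>\<^sub>E UNIV. \<forall>p. p permutes {..<n} \<longrightarrow> M (x \<circ> p) = M x)"

definition n_continuous :: "nat \<Rightarrow> ((nat \<Rightarrow> 'a::topological_space) \<Rightarrow> real) \<Rightarrow> bool" where
  "n_continuous n M \<longleftrightarrow>
     continuous_map (product_topology (\<lambda>_. euclidean) {..<n}) euclideanreal M"

definition diag :: "nat \<Rightarrow> 'a \<Rightarrow> nat \<Rightarrow> 'a" where
  "diag n x = (\<lambda>i\<in>{..<n}. x)"

definition is_sym_form ::
    "nat \<Rightarrow> ('a::real_normed_vector \<Rightarrow> real) \<Rightarrow> ((nat \<Rightarrow> 'a) \<Rightarrow> real) \<Rightarrow> bool" where
  "is_sym_form n P M \<longleftrightarrow>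
     n_linear n M \<and> n_symmetric n M \<and> n_continuous n M \<and> (\<forall>x. P x = M (diag n x))"

definition hom_polys :: "nat \<Rightarrow> ('a::real_normed_vector \<Rightarrow> real) set" where
  "hom_polys n = {P. \<exists>M. is_sym_form n P M}"

definition poly_norm :: "('a::real_normed_vector \<Rightarrow> real) \<Rightarrow> real" where
  "poly_norm P = (SUP x \<in> cball 0 1. \<bar>P x\<bar>)"

section \<open>The completed symmetric projective tensor product\<close>

text \<open>As usual, \<open>x\<^sub>1 \<otimes> \<dots> \<otimes> x\<^sub>n\<close> is the functional \<open>M \<mapsto> M (x\<^sub>1, \<dots>, x\<^sub>n)\<close> on the space of all
  (algebraically) \<open>n\<close>-linear forms.  The value off that space is set to \<open>0\<close>, so that equality of
  tensors is equality of functions.\<close>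

type_synonym 'a tensor = "((nat \<Rightarrow> 'a) \<Rightarrow> real) \<Rightarrow> real"

definition tensor_power :: "nat \<Rightarrow> 'a::real_vector \<Rightarrow> 'a tensor" where
  "tensor_power n x = (\<lambda>M. if n_linear n M then M (diag n x) else 0)"

definition tensor_comb :: "nat \<Rightarrow> nat \<Rightarrow> (nat \<Rightarrow> real) \<Rightarrow> (nat \<Rightarrow> 'a::real_vector) \<Rightarrow> 'a tensor" where
  "tensor_comb n m c x = (\<lambda>M. \<Sum>j<m. c j * tensor_power n (x j) M)"

definition sym_tensors :: "nat \<Rightarrow> 'a::real_vector tensor set" where
  "sym_tensors n = {u. \<exists>m c x. u = tensor_comb n m c x}"

definition proj_norm :: "nat \<Rightarrow> 'a::real_normed_vector tensor \<Rightarrow> real" where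
  "proj_norm n u = Inf {(\<Sum>j<m. \<bar>c j\<bar> * norm (x j) ^ n) |m c x. u = tensor_comb n m c x}"

text \<open>The completion consists of the Cauchy sequences modulo null sequences.\<close>

definition tensor_cauchy :: "nat \<Rightarrow> (nat \<Rightarrow> 'a::real_normed_vector tensor) set" where
  "tensor_cauchy n = {u. (\<forall>k. u k \<in> sym_tensors n) \<and>
     (\<forall>e>0. \<exists>K. \<forall>k\<ge>K. \<forall>l\<ge>K. proj_norm n (u k - u l) < e)}"

definition tensor_equiv ::
    "nat \<Rightarrow> ((nat \<Rightarrow> 'a::real_normed_vector tensor) \<times> (nat \<Rightarrow> 'a tensor)) set" where
  "tensor_equiv n = {(u, v). u \<in> tensor_cauchy n \<and> v \<in> tensor_cauchy n \<and>
     (\<lambda>k. proj_norm n (u k - v k)) \<longlonglongrightarrow> 0}"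

definition sym_predual :: "nat \<Rightarrow> (nat \<Rightarrow> 'a::real_normed_vector tensor) set set" where
  "sym_predual n = tensor_cauchy n // tensor_equiv n"

text \<open>On the algebraic symmetric tensors the duality is evaluation at the symmetric form of the
  polynomial, i.e. the linear extension of \<open>\<langle>P, x\<^sup>\<otimes>\<^sup>n\<rangle> = P x\<close> (lemma \<open>poly_apply_tensor_comb\<close>); it
  is extended to the completion by taking limits (lemma \<open>poly_pairing_tendsto\<close>).\<close>

definition poly_apply :: "nat \<Rightarrow> ('a::real_normed_vector \<Rightarrow> real) \<Rightarrow> 'a tensor \<Rightarrow> real" where
  "poly_apply n P u = u (SOME M. is_sym_form n P M)"

definition poly_pairing ::
    "nat \<Rightarrow> ('a::real_normed_vector \<Rightarrow> real) \<Rightarrow> (nat \<Rightarrow> 'a tensor) set \<Rightarrow> real" where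
  "poly_pairing n P C = (THE r. \<forall>u\<in>C. (\<lambda>k. poly_apply n P (u k)) \<longlonglongrightarrow> r)"

section \<open>The weak-star Kadec--Klee property\<close>

text \<open>\<open>V\<close> is a dual space with norm \<open>N\<close>, and \<open>E\<close> its fixed predual with duality \<open>pair\<close>.  Nets are
  rendered by filters.  Filters on \<open>V\<close> itself suffice: lemmas \<open>weak_star_KK_net\<close> and
  \<open>not_weak_star_KK_net\<close> below show that the property says exactly what is required for nets
  over arbitrary directed sets.\<close>

definition weak_star_topology :: "'v set \<Rightarrow> 'e set \<Rightarrow> ('v \<Rightarrow> 'e \<Rightarrow> real) \<Rightarrow> 'v topology" where
  "weak_star_topology V E pair =
     topology_generated_by {{v \<in> V. pair v e \<in> U} |e U. e \<in> E \<and> open U}"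

definition weak_star_KK ::
    "'v::minus set \<Rightarrow> ('v \<Rightarrow> real) \<Rightarrow> 'e set \<Rightarrow> ('v \<Rightarrow> 'e \<Rightarrow> real) \<Rightarrow> bool" where
  "weak_star_KK V N E pair \<longleftrightarrow>
     (\<forall>F. \<forall>x\<in>V. N x = 1 \<longrightarrow> (\<forall>\<^sub>F y in F. y \<in> V \<and> N y = 1) \<longrightarrow>
        limitin (weak_star_topology V E pair) (\<lambda>y. y) x F \<longrightarrow> ((\<lambda>y. N (y - x)) \<longlongrightarrow> 0) F)"

definition directed :: "'i set \<Rightarrow> ('i \<times> 'i) set \<Rightarrow> bool" where
  "directed A r \<longleftrightarrow> A \<noteq> {} \<and> r \<subseteq> A \<times> A \<and> refl_on A r \<and> trans r \<and>
     (\<forall>a\<in>A. \<forall>b\<in>A. \<exists>c\<in>A. (a, c) \<in> r \<and> (b, c) \<in> r)"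

definition net_filter :: "'i set \<Rightarrow> ('i \<times> 'i) set \<Rightarrow> 'i filter" where
  "net_filter A r = (INF a\<in>A. principal {b \<in> A. (a, b) \<in> r})"

lemma eventually_net_filter:
  assumes "directed A r"
  shows "eventually Q (net_filter A r) \<longleftrightarrow> (\<exists>a\<in>A. \<forall>b\<in>A. (a, b) \<in> r \<longrightarrow> Q b)"
proof -
  have "\<exists>c\<in>A. principal {d \<in> A. (c, d) \<in> r} \<le>
      inf (principal {d \<in> A. (a, d) \<in> r}) (principal {d \<in> A. (b, d) \<in> r})"
    if ab: "a \<in> A" "b \<in> A" for a b
  proof -
    obtain c where c: "c \<in> A" "(a, c) \<in> r" "(b, c) \<in> r"
      using assms ab unfolding directed_def by blast
    have "{d \<in> A. (c, d) \<in> r} \<subseteq> {d \<in> A. (a, d) \<in> r} \<inter> {d \<in> A. (b, d) \<in> r}"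
      using assms c unfolding directed_def trans_def by blast
    then show ?thesis
      using c by (intro bexI[of _ c]) auto
  qed
  then show ?thesis
    unfolding net_filter_def using assms
    by (subst eventually_INF_base) (auto simp: eventually_principal directed_def)
qed

lemma weak_star_KK_net:
  assumes "weak_star_KK V N E pair" "x \<in> V" "N x = 1"
    and "\<And>i. i \<in> A \<Longrightarrow> f i \<in> V \<and> N (f i) = 1" and "directed A r"
    and "limitin (weak_star_topology V E pair) f x (net_filter A r)"
  shows "((\<lambda>i. N (f i - x)) \<longlongrightarrow> 0) (net_filter A r)"
proof -
  let ?F = "filtermap f (net_filter A r)"
  have "eventually (\<lambda>y. y \<in> V \<and> N y = 1) ?F"
    using assms(4,5) by (auto simp: eventually_filtermap eventually_net_filter directed_def)
  moreover have "limitin (weak_star_topology V E pair) (\<lambda>y. y) x ?F"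
    using assms(6) by (simp add: limitin_def eventually_filtermap)
  ultimately have "((\<lambda>y. N (y - x)) \<longlongrightarrow> 0) ?F"
    using assms(1-3) unfolding weak_star_KK_def by blast
  then show ?thesis
    by (simp add: filterlim_filtermap)
qed

lemma not_weak_star_KK_net:
  fixes V :: "'v::minus set"
  assumes "\<not> weak_star_KK V N E pair"
  shows "\<exists>(A :: ('v set \<times> 'v) set) r f. \<exists>x\<in>V. N x = 1 \<and> directed A r \<and>
    (\<forall>i\<in>A. f i \<in> V \<and> N (f i) = 1) \<and>
    limitin (weak_star_topology V E pair) f x (net_filter A r) \<and>
    \<not> ((\<lambda>i. N (f i - x)) \<longlongrightarrow> 0) (net_filter A r)"
proof -
  obtain F x where x: "x \<in> V" "N x = 1"
    and F: "\<forall>\<^sub>F y in F. y \<in> V \<and> N y = 1" "limitin (weak_star_topology V E pair) (\<lambda>y. y) x F"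
      "\<not> ((\<lambda>y. N (y - x)) \<longlongrightarrow> 0) F"
    using assms unfolding weak_star_KK_def by blast
  define A where "A = {(S, y). (\<forall>\<^sub>F z in F. z \<in> S) \<and> y \<in> S \<and> y \<in> V \<and> N y = 1}"
  define r where "r = {(a, b). a \<in> A \<and> b \<in> A \<and> fst b \<subseteq> fst a}"
  have "F \<noteq> bot"
    using F(3) by auto
  then have ne: "\<exists>y. (S, y) \<in> A" if "\<forall>\<^sub>F z in F. z \<in> S" for S
    using eventually_happens'[OF _ eventually_conj[OF that F(1)]] that by (auto simp: A_def)
  have dir: "directed A r"
    unfolding directed_def
  proof (intro conjI ballI)
    show "A \<noteq> {}"
      using ne[of UNIV] by auto
    show "r \<subseteq> A \<times> A" "refl_on A r" "trans r"
      by (auto simp: r_def refl_on_def trans_def)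
    fix a b assume ab: "a \<in> A" "b \<in> A"
    then have "\<forall>\<^sub>F z in F. z \<in> fst a \<inter> fst b"
      by (auto simp: A_def intro: eventually_conj)
    then obtain y where y: "(fst a \<inter> fst b, y) \<in> A"
      using ne by blast
    show "\<exists>c\<in>A. (a, c) \<in> r \<and> (b, c) \<in> r"
      using ab y by (intro bexI[OF _ y]) (auto simp: r_def)
  qed
  have ev: "eventually (\<lambda>i. Q (snd i)) (net_filter A r) \<longleftrightarrow> eventually Q F" for Q
  proof
    assume "eventually (\<lambda>i. Q (snd i)) (net_filter A r)"
    then obtain a where a: "a \<in> A" "\<forall>b\<in>A. (a, b) \<in> r \<longrightarrow> Q (snd b)"
      using dir by (auto simp: eventually_net_filter)
    have "Q y" if "y \<in> fst a \<and> y \<in> V \<and> N y = 1" for y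
    proof -
      have "(fst a, y) \<in> A"
        using a(1) that by (auto simp: A_def)
      then show ?thesis
        using a by (force simp: r_def)
    qed
    moreover have "\<forall>\<^sub>F z in F. z \<in> fst a"
      using a(1) by (auto simp: A_def)
    ultimately show "eventually Q F"
      using F(1) by (auto elim: eventually_elim2)
  next
    assume Q: "eventually Q F"
    then obtain y where y: "({z. Q z}, y) \<in> A"
      using ne[of "{z. Q z}"] by auto
    show "eventually (\<lambda>i. Q (snd i)) (net_filter A r)"
      unfolding eventually_net_filter[OF dir]
      using y by (intro bexI[OF _ y]) (auto simp: r_def A_def)
  qed
  have "\<not> ((\<lambda>i. N (snd i - x)) \<longlongrightarrow> 0) (net_filter A r)"
    using F(3) by (simp add: tendsto_iff ev[where Q = "\<lambda>y. \<bar>N (y - x)\<bar> < e" for e])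
  moreover have "limitin (weak_star_topology V E pair) snd x (net_filter A r)"
    using F(2) by (simp add: limitin_def ev[where Q = "\<lambda>y. y \<in> U" for U])
  moreover have "\<forall>i\<in>A. snd i \<in> V \<and> N (snd i) = 1"
    by (auto simp: A_def)
  ultimately show ?thesis
    using x dir by (intro exI[of _ A] exI[of _ r] exI[of _ snd] bexI[of _ x]) auto
qed

section \<open>The duality is well defined\<close>

lemma diag_in: "diag n x \<in> {..<n} \<rightarrow>\<^sub>E UNIV"
  by (simp add: diag_def)

lemma some_sym_form:
  assumes "P \<in> hom_polys n"
  shows "is_sym_form n P (SOME M. is_sym_form n P M)"
proof -
  obtain M where "is_sym_form n P M"
    using assms unfolding hom_polys_def by blast
  then show ?thesis
    by (rule someI[of "is_sym_form n P"])
qed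

lemma poly_apply_tensor_comb:
  assumes "P \<in> hom_polys n"
  shows "poly_apply n P (tensor_comb n m c x) = (\<Sum>j<m. c j * P (x j))"
proof -
  define M where "M = (SOME M. is_sym_form n P M)"
  have "is_sym_form n P M"
    using some_sym_form[OF assms] unfolding M_def .
  then have M: "n_linear n M" "\<And>x. M (diag n x) = P x"
    by (auto simp: is_sym_form_def)
  show ?thesis
    unfolding poly_apply_def M_def[symmetric] by (simp add: tensor_comb_def tensor_power_def M)
qed

lemma hom_poly_scaleR:
  assumes "P \<in> hom_polys n"
  shows "P (c *\<^sub>R x) = c ^ n * P x"
proof -
  obtain M where M: "n_linear n M" "\<And>x. P x = M (diag n x)"
    using assms by (auto simp: hom_polys_def is_sym_form_def)
  define y where "y k = (\<lambda>i\<in>{..<n}. if i < k then c *\<^sub>R x else x)" for k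
  have "M (y k) = c ^ k * M (diag n x)" if "k \<le> n" for k
    using that
  proof (induction k)
    case 0
    have "y 0 = diag n x"
      by (auto simp: y_def diag_def)
    then show ?case by simp
  next
    case (Suc k)
    have lin: "linear (\<lambda>t. M ((y k)(k := t)))"
      using M(1) Suc.prems by (auto simp: n_linear_def y_def)
    have step: "y (Suc k) = (y k)(k := c *\<^sub>R x)" and same: "(y k)(k := x) = y k"
      using Suc.prems by (auto simp: y_def fun_eq_iff)
    show ?case
      using linear_cmul[OF lin, of c x] Suc unfolding step same by (metis Suc_leD mult.assoc power_Suc real_scaleR_def)
  qed
  from this[of n] have "M (y n) = c ^ n * M (diag n x)"
    by simp
  moreover have "y n = diag n (c *\<^sub>R x)"
    by (auto simp: y_def diag_def)
  ultimately show ?thesis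
    by (simp add: M(2))
qed

lemma hom_poly_continuous:
  assumes "P \<in> hom_polys n"
  shows "continuous_on UNIV P"
proof -
  obtain M where M: "n_continuous n M" "P = M \<circ> diag n"
    using assms by (auto simp: hom_polys_def is_sym_form_def fun_eq_iff)
  have "continuous_map euclidean (product_topology (\<lambda>_. euclidean) {..<n}) (diag n :: 'a \<Rightarrow> _)"
    by (auto simp: continuous_map_componentwise diag_def)
  then have "continuous_map euclidean euclideanreal P"
    using M(1) continuous_map_compose unfolding M(2) n_continuous_def by blast
  then show ?thesis
    by simp
qed

lemma hom_poly_bound:
  assumes P: "P \<in> hom_polys n" and n: "n > 0"
  obtains B where "B \<ge> 0" "\<And>x. \<bar>P x\<bar> \<le> B * norm x ^ n"
proof -
  have P0: "P 0 = 0"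
    using hom_poly_scaleR[OF P, of 0 0] n by (simp add: zero_power)
  obtain d where d: "d > 0" "\<And>x. norm x < d \<Longrightarrow> \<bar>P x\<bar> < 1"
  proof -
    obtain d where "d > 0" "\<forall>x\<in>UNIV. dist x 0 < d \<longrightarrow> dist (P x) (P 0) < 1"
      using hom_poly_continuous[OF P] unfolding continuous_on_iff by (meson UNIV_I zero_less_one)
    then show ?thesis
      by (intro that[of d]) (auto simp: P0)
  qed
  have "\<bar>P x\<bar> \<le> (2 / d) ^ n * norm x ^ n" for x
  proof (cases "x = 0")
    case False
    define c where "c = d / (2 * norm x)"
    have c: "c > 0"
      using d(1) False by (simp add: c_def)
    have "norm (c *\<^sub>R x) < d"
      using d(1) False by (simp add: c_def)
    from d(2)[OF this] have "c ^ n * \<bar>P x\<bar> < 1"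
      using c by (simp add: hom_poly_scaleR[OF P] abs_mult)
    then have "\<bar>P x\<bar> \<le> (1 / c) ^ n"
      using c by (simp add: field_simps)
    also have "1 / c = 2 / d * norm x"
      by (simp add: c_def)
    finally show ?thesis
      unfolding power_mult_distrib .
  qed (use d(1) in \<open>simp add: P0\<close>)
  then show ?thesis
    using d(1) by (intro that[of "(2 / d) ^ n"]) auto
qed

lemma proj_norm_bound:
  assumes P: "P \<in> hom_polys n" and B: "B \<ge> 0" "\<And>x. \<bar>P x\<bar> \<le> B * norm x ^ n"
    and u: "u \<in> sym_tensors n"
  shows "\<bar>poly_apply n P u\<bar> \<le> B * proj_norm n u"
proof -
  let ?S = "{(\<Sum>j<m. \<bar>c j\<bar> * norm (x j) ^ n) |m c x. u = tensor_comb n m c x}"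
  have le: "\<bar>poly_apply n P u\<bar> \<le> B * s" if st: "s \<in> ?S" for s
  proof -
    obtain m c and x :: "nat \<Rightarrow> 'a" where
      s: "s = (\<Sum>j<m. \<bar>c j\<bar> * norm (x j) ^ n)" "u = tensor_comb n m c x"
      using st by blast
    have "\<bar>poly_apply n P u\<bar> \<le> (\<Sum>j<m. \<bar>c j * P (x j)\<bar>)"
      by (simp add: s(2) poly_apply_tensor_comb[OF P] sum_abs)
    also have "\<dots> \<le> (\<Sum>j<m. \<bar>c j\<bar> * (B * norm (x j) ^ n))"
      by (intro sum_mono) (auto simp: abs_mult intro!: mult_left_mono B)
    also have "\<dots> = B * s"
      by (simp add: s(1) sum_distrib_left mult_ac)
    finally show ?thesis .
  qed
  have ne: "?S \<noteq> {}"
    using u by (auto simp: sym_tensors_def)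
  show ?thesis
  proof (cases "B = 0")
    case True
    then show ?thesis
      using ne le by fastforce
  next
    case False
    then have "\<bar>poly_apply n P u\<bar> / B \<le> proj_norm n u"
      unfolding proj_norm_def using B(1) le
      by (intro cInf_greatest[OF ne]) (simp add: field_simps)
    then show ?thesis
      using B(1) False by (simp add: field_simps)
  qed
qed

lemma sym_tensors_diff:
  assumes "u \<in> sym_tensors n" "v \<in> sym_tensors n"
  shows "u - v \<in> sym_tensors n"
proof -
  obtain m c x where u: "u = tensor_comb n m c x"
    using assms(1) by (auto simp: sym_tensors_def)
  obtain m' c' x' where v: "v = tensor_comb n m' c' x'"
    using assms(2) by (auto simp: sym_tensors_def)
  have split: "(\<Sum>j<m + m'. g j) = (\<Sum>j<m. g j) + (\<Sum>j<m'. g (m + j))" for g :: "nat \<Rightarrow> real"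
    by (induction m') auto
  have "u - v = tensor_comb n (m + m')
      (\<lambda>j. if j < m then c j else - c' (j - m)) (\<lambda>j. if j < m then x j else x' (j - m))"
    by (simp add: fun_eq_iff u v tensor_comb_def split sum_negf)
  then show ?thesis
    unfolding sym_tensors_def by blast
qed

lemma poly_pairing_tendsto:
  assumes P: "P \<in> hom_polys n" and n: "n > 0"
    and C: "C \<in> sym_predual n" and u: "u \<in> C"
  shows "(\<lambda>k. poly_apply n P (u k)) \<longlonglongrightarrow> poly_pairing n P C"
proof -
  obtain B where B: "B \<ge> 0" "\<And>x. \<bar>P x\<bar> \<le> B * norm x ^ n"
    using hom_poly_bound[OF P n] by blast
  have diff: "\<bar>poly_apply n P v - poly_apply n P w\<bar> \<le> B * proj_norm n (v - w)"
    if "v \<in> sym_tensors n" "w \<in> sym_tensors n" for v w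
    using proj_norm_bound[OF P B sym_tensors_diff[OF that]] by (simp add: poly_apply_def)
  obtain w where w: "w \<in> tensor_cauchy n" "C = tensor_equiv n `` {w}"
    using C by (auto simp: sym_predual_def quotient_def)
  have wt: "w k \<in> sym_tensors n" for k
    using w by (simp add: tensor_cauchy_def)
  have "Cauchy (\<lambda>k. poly_apply n P (w k))"
  proof (rule CauchyI)
    fix e :: real assume "e > 0"
    then have "e / (B + 1) > 0"
      using B(1) by simp
    then obtain K where K: "\<And>k l. k \<ge> K \<Longrightarrow> l \<ge> K \<Longrightarrow> proj_norm n (w k - w l) < e / (B + 1)"
      using w(1) unfolding tensor_cauchy_def by blast
    show "\<exists>K. \<forall>k\<ge>K. \<forall>l\<ge>K. norm (poly_apply n P (w k) - poly_apply n P (w l)) < e"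
    proof (intro exI allI impI)
      fix k l assume "K \<le> k" "K \<le> l"
      have "norm (poly_apply n P (w k) - poly_apply n P (w l)) \<le> B * proj_norm n (w k - w l)"
        using diff[OF wt wt] by simp
      also have "\<dots> \<le> B * (e / (B + 1))"
        using K[OF \<open>K \<le> k\<close> \<open>K \<le> l\<close>] B(1) by (intro mult_left_mono) auto
      also have "\<dots> < e"
        using \<open>e > 0\<close> B(1) by (simp add: field_simps)
      finally show "norm (poly_apply n P (w k) - poly_apply n P (w l)) < e" .
    qed
  qed
  then obtain r where r: "(\<lambda>k. poly_apply n P (w k)) \<longlonglongrightarrow> r"
    using real_Cauchy_convergent convergent_def by blast
  have all: "(\<lambda>k. poly_apply n P (v k)) \<longlonglongrightarrow> r" if "v \<in> C" for v
  proof -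
    have v: "\<And>k. v k \<in> sym_tensors n" "(\<lambda>k. proj_norm n (w k - v k)) \<longlonglongrightarrow> 0"
      using that w by (auto simp: tensor_equiv_def tensor_cauchy_def)
    have "(\<lambda>k. poly_apply n P (w k) - poly_apply n P (v k)) \<longlonglongrightarrow> 0"
    proof (rule Lim_null_comparison)
      show "(\<lambda>k. B * proj_norm n (w k - v k)) \<longlonglongrightarrow> 0"
        using tendsto_mult_right_zero[OF v(2)] by simp
    qed (use diff[OF wt v(1)] in simp)
    from tendsto_diff[OF r this] show ?thesis
      by simp
  qed
  have "poly_pairing n P C = r"
    unfolding poly_pairing_def
    using all u by (intro the_equality) (auto intro: LIMSEQ_unique)
  then show ?thesis
    using all[OF u] by simp
qed

end

theory Submission
  imports Defs
begin

text \<open>If \<open>f\<close> and \<open>g\<close> are functionals of norm at most \<open>1\<close>, then \<open>f\<^sup>2\<close> and \<open>g\<^sup>2\<close> take values in \<open>[0, 1]\<close>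
  on the unit ball, so that \<open>f\<^sup>n\<^sup>-\<^sup>2 (f\<^sup>2 - g\<^sup>2)\<close> is a polynomial of norm at most \<open>1\<close>.  Fix \<open>f\<close> with
  \<open>f a = 1 = \<parallel>a\<parallel>\<close>, and for every finite set \<open>A\<close> choose by the Hahn--Banach theorem a functional
  \<open>g\<close>, of norm between \<open>1/2\<close> and \<open>1\<close>, that vanishes on \<open>A \<union> {a}\<close>; this is possible because \<open>X\<close> is
  infinite-dimensional.  The polynomials \<open>f\<^sup>n\<^sup>-\<^sup>2 (f\<^sup>2 - g\<^sup>2)\<close> then have norm \<open>1\<close> and converge
  pointwise to \<open>f\<^sup>n\<close>, but their distance \<open>\<parallel>f\<^sup>n\<^sup>-\<^sup>2 g\<^sup>2\<parallel>\<close> to \<open>f\<^sup>n\<close> is bounded below.\<close>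

section \<open>Linear functionals below a sublinear functional\<close>

definition sublinear :: "('a::real_vector \<Rightarrow> real) \<Rightarrow> bool" where
  "sublinear q \<longleftrightarrow> (\<forall>x y. q (x + y) \<le> q x + q y) \<and> (\<forall>c\<ge>0. \<forall>x. q (c *\<^sub>R x) = c * q x)"

text \<open>The scaling inequality for positive \<open>c\<close> is enough: applied to
  \<open>1 / c\<close> and \<open>c *\<^sub>R x\<close> it gives the reverse inequality.\<close>

lemma sublinearI:
  assumes add: "\<And>x y. q (x + y) \<le> q x + q y" and zero: "q 0 = 0"
    and scale: "\<And>c x. c > 0 \<Longrightarrow> q (c *\<^sub>R x) \<le> c * q x"
  shows "sublinear q"
  unfolding sublinear_def
proof (intro conjI allI impI add)
  fix c :: real and x :: 'a assume "c \<ge> 0"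
  show "q (c *\<^sub>R x) = c * q x"
  proof (cases "c = 0")
    case False
    with \<open>c \<ge> 0\<close> have c: "c > 0" by simp
    have "q x \<le> (1 / c) * q (c *\<^sub>R x)"
      using scale[of "1 / c" "c *\<^sub>R x"] c by simp
    then have "c * q x \<le> q (c *\<^sub>R x)"
      using c by (simp add: field_simps)
    then show ?thesis
      using scale[OF c, of x] by linarith
  qed (simp add: zero)
qed

lemma sublinear_add: "sublinear q \<Longrightarrow> q (x + y) \<le> q x + q y"
  and sublinear_scale: "sublinear q \<Longrightarrow> c \<ge> 0 \<Longrightarrow> q (c *\<^sub>R x) = c * q x"
  by (auto simp: sublinear_def)

lemma sublinear_0: "sublinear q \<Longrightarrow> q 0 = 0"
  using sublinear_scale[of q 0 0] by simp

lemma sublinear_minus: "sublinear q \<Longrightarrow> - q (- x) \<le> q x"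
  using sublinear_add[of q x "- x"] sublinear_0[of q] by simp

text \<open>The auxiliary functional of the Hahn--Banach argument. It lies below \<open>q\<close>,
  and its value at \<open>- y\<close> is at most \<open>- q y\<close>, so a linear functional below
  it must agree with \<open>q\<close> at \<open>y\<close>.\<close>

definition slide :: "('a::real_vector \<Rightarrow> real) \<Rightarrow> 'a \<Rightarrow> 'a \<Rightarrow> real" where
  "slide q y x = (INF t\<in>{0..}. q (x + t *\<^sub>R y) - t * q y)"

lemma slide_le:
  assumes "sublinear q" "t \<ge> 0"
  shows "slide q y x \<le> q (x + t *\<^sub>R y) - t * q y"
proof -
  \<comment> \<open>A lower bound independent of \<open>s\<close>, so that the real infimum defining
    \<open>slide\<close> is a genuine one.\<close>
  have "- q (- x) \<le> q (x + s *\<^sub>R y) - s * q y" if "s \<ge> 0" for s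
    using sublinear_add[OF assms(1), of "x + s *\<^sub>R y" "- x"] sublinear_scale[OF assms(1) that, of y]
    by simp
  then have "bdd_below ((\<lambda>t. q (x + t *\<^sub>R y) - t * q y) ` {0..})"
    by (intro bdd_belowI2[of _ "- q (- x)"]) auto
  then show ?thesis
    unfolding slide_def using assms(2) by (intro cINF_lower) auto
qed

lemma slide_le_self: "sublinear q \<Longrightarrow> slide q y x \<le> q x"
  using slide_le[of q 0 y x] by simp

lemma slide_uminus: "sublinear q \<Longrightarrow> slide q y (- y) \<le> - q y"
  using slide_le[of q 1 y "- y"] sublinear_0[of q] by simp

lemma slide_greatest: "(\<And>t. t \<ge> 0 \<Longrightarrow> b \<le> q (x + t *\<^sub>R y) - t * q y) \<Longrightarrow> b \<le> slide q y x"
  unfolding slide_def by (intro cINF_greatest) auto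

text \<open>Parameters \<open>s\<close> for \<open>x\<close> and \<open>t\<close> for
  \<open>z\<close> combine to \<open>s + t\<close> for the sum, and scaling by \<open>c\<close>
  turns \<open>t\<close> into \<open>c * t\<close>; taking infima over the parameters gives both
  properties.\<close>

lemma sublinear_slide:
  assumes q: "sublinear q"
  shows "sublinear (slide q y)"
proof (rule sublinearI)
  fix x z
  have *: "slide q y (x + z) \<le> (q (x + s *\<^sub>R y) - s * q y) + (q (z + t *\<^sub>R y) - t * q y)"
    if "s \<ge> 0" "t \<ge> 0" for s t
  proof -
    have "slide q y (x + z) \<le> q (x + z + (s + t) *\<^sub>R y) - (s + t) * q y"
      using that by (intro slide_le q) auto
    also have "q (x + z + (s + t) *\<^sub>R y) \<le> q (x + s *\<^sub>R y) + q (z + t *\<^sub>R y)"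
      using sublinear_add[OF q, of "x + s *\<^sub>R y" "z + t *\<^sub>R y"] by (simp add: algebra_simps)
    finally show ?thesis by (simp add: algebra_simps)
  qed
  have "slide q y (x + z) - (q (x + s *\<^sub>R y) - s * q y) \<le> slide q y z" if "s \<ge> 0" for s
    using *[OF that] by (intro slide_greatest) (simp add: algebra_simps)
  then have "slide q y (x + z) - slide q y z \<le> slide q y x"
    by (intro slide_greatest) (smt (verit))
  then show "slide q y (x + z) \<le> slide q y x + slide q y z"
    by simp
next
  have "0 \<le> slide q y 0"
    using q by (intro slide_greatest) (simp add: sublinear_scale)
  then show "slide q y 0 = 0"
    using slide_le_self[OF q, of y 0] sublinear_0[OF q] by simp
next
  fix c :: real and x assume c: "c > 0"
  have "slide q y (c *\<^sub>R x) / c \<le> q (x + t *\<^sub>R y) - t * q y" if "t \<ge> 0" for t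
  proof -
    have "slide q y (c *\<^sub>R x) \<le> q (c *\<^sub>R x + (c * t) *\<^sub>R y) - (c * t) * q y"
      using that c by (intro slide_le q) auto
    also have "c *\<^sub>R x + (c * t) *\<^sub>R y = c *\<^sub>R (x + t *\<^sub>R y)"
      by (simp add: algebra_simps)
    also have "q \<dots> = c * q (x + t *\<^sub>R y)"
      using sublinear_scale[OF q] c by simp
    finally show ?thesis
      using c by (simp add: field_simps)
  qed
  then have "slide q y (c *\<^sub>R x) / c \<le> slide q y x"
    by (rule slide_greatest)
  then show "slide q y (c *\<^sub>R x) \<le> c * slide q y x"
    using c by (simp add: field_simps)
qed

text \<open>Sliding does not change a minimal sublinear functional, which makes it superadditive.\<close>

lemma linear_of_minimal_sublinear:
  assumes q: "sublinear q" and min: "\<And>r. sublinear r \<Longrightarrow> (\<And>x. r x \<le> q x) \<Longrightarrow> r = q"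
  shows "linear q"
proof -
  have "slide q y = q" for y
    by (intro min sublinear_slide q slide_le_self)
  then have ge: "q x + q y \<le> q (x + y)" for x y
    using slide_le[OF q, of 1 y x] by simp
  have add: "q (x + y) = q x + q y" for x y
    using ge sublinear_add[OF q] by (intro antisym)
  have neg: "q (- x) = - q x" for x
    using add[of x "- x"] sublinear_0[OF q] by simp
  have "q (c *\<^sub>R x) = c * q x" for c x
  proof (cases "c \<ge> 0")
    case False
    then show ?thesis
      using sublinear_scale[OF q, of "- c" x] neg[of "c *\<^sub>R x"] by simp
  qed (simp add: sublinear_scale[OF q])
  then show ?thesis
    by (intro linearI add) simp
qed

text \<open>Supplies the lower bounds for Zorn's lemma. Subadditivity uses the chain condition: of
  two members evaluated at \<open>x\<close> and at \<open>y\<close>, the smaller one can replace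
  both. The infimum is finite because every member is bounded below by \<open>- p (- x)\<close> at
  \<open>x\<close>.\<close>

lemma sublinear_chain_Inf:
  assumes ne: "C \<noteq> {}" and sub: "\<And>q. q \<in> C \<Longrightarrow> sublinear q"
    and below: "\<And>q x. q \<in> C \<Longrightarrow> q x \<le> p x"
    and chain: "\<And>q r. q \<in> C \<Longrightarrow> r \<in> C \<Longrightarrow> q \<le> r \<or> r \<le> q"
  defines "u \<equiv> \<lambda>x. INF q\<in>C. q x"
  shows "sublinear u" "\<And>q x. q \<in> C \<Longrightarrow> u x \<le> q x"
proof -
  have "- p (- x) \<le> q x" if "q \<in> C" for q x
    using sublinear_minus[OF sub[OF that], of x] below[OF that, of "- x"] by linarith
  then have bdd: "bdd_below ((\<lambda>q. q x) ` C)" for x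
    by (intro bdd_belowI2[of _ "- p (- x)"]) auto
  show le: "u x \<le> q x" if "q \<in> C" for q x
    unfolding u_def using bdd that by (intro cINF_lower) auto
  have greatest: "b \<le> u x" if "\<And>q. q \<in> C \<Longrightarrow> b \<le> q x" for b x
    unfolding u_def using ne that by (intro cINF_greatest) auto
  show "sublinear u"
  proof (rule sublinearI)
    fix x y
    have *: "u (x + y) \<le> q x + r y" if qr: "q \<in> C" "r \<in> C" for q r
    proof -
      obtain s where "s \<in> C" "s \<le> q" "s \<le> r"
        using chain[OF qr] qr by blast
      then have "u (x + y) \<le> s (x + y)" "s (x + y) \<le> s x + s y" "s x \<le> q x" "s y \<le> r y"
        using le sublinear_add[OF sub] by (auto simp: le_fun_def)
      then show ?thesis by linarith
    qed
    have "u (x + y) - q x \<le> u y" if "q \<in> C" for q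
      using *[OF that] by (intro greatest) (simp add: algebra_simps)
    then have "u (x + y) - u y \<le> u x"
      by (intro greatest) (smt (verit))
    then show "u (x + y) \<le> u x + u y" by simp
  next
    show "u 0 = 0"
      using ne by (simp add: u_def sublinear_0[OF sub] cong: INF_cong_simp)
  next
    fix c :: real and x assume c: "c > 0"
    have "u (c *\<^sub>R x) / c \<le> u x"
    proof (rule greatest)
      fix q assume "q \<in> C"
      then show "u (c *\<^sub>R x) / c \<le> q x"
        using le[of q "c *\<^sub>R x"] sublinear_scale[OF sub, of q c x] c by (simp add: field_simps)
    qed
    then show "u (c *\<^sub>R x) \<le> c * u x"
      using c by (simp add: field_simps)
  qed
qed

text \<open>Zorn's lemma for the reversed pointwise order gives a minimal element among the
  sublinear functionals below \<open>p\<close>. Anything sublinear below it is again below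
  \<open>p\<close>, so it is minimal without restriction and hence linear.\<close>

lemma linear_below_sublinear:
  assumes p: "sublinear p"
  obtains f where "linear f" "\<And>x. f x \<le> p x"
proof -
  define A where "A = {q. sublinear q \<and> (\<forall>x. q x \<le> p x)}"
  have A_D: "sublinear q" "q x \<le> p x" if "q \<in> A" for q x
    using that by (auto simp: A_def)
  have "\<exists>m\<in>A. \<forall>a\<in>A. a \<le> m \<longrightarrow> a = m"
  proof (rule predicate_Zorn)
    show "partial_order_on A (relation_of (\<lambda>a b. b \<le> a) A)"
      by (rule partial_order_on_relation_ofI) auto
  next
    fix C assume C: "C \<in> Chains (relation_of (\<lambda>a b. b \<le> a) A)"
    then have CA: "C \<subseteq> A" and chain: "\<And>q r. q \<in> C \<Longrightarrow> r \<in> C \<Longrightarrow> q \<le> r \<or> r \<le> q"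
      by (auto simp: Chains_def relation_of_def)
    show "\<exists>u\<in>A. \<forall>a\<in>C. u \<le> a"
    proof (cases "C = {}")
      case True
      then show ?thesis using p by (auto simp: A_def)
    next
      case False
      define u where "u = (\<lambda>x. INF q\<in>C. q x)"
      have "sublinear u" and le: "\<And>q x. q \<in> C \<Longrightarrow> u x \<le> q x"
        unfolding u_def using CA chain
        by (intro sublinear_chain_Inf[OF False, where p = p]; blast dest: A_D)+
      moreover obtain q where q: "q \<in> C" "q \<in> A" using False CA by blast
      have "u x \<le> p x" for x
        using le[OF q(1)] A_D(2)[OF q(2)] by (rule order_trans)
      ultimately have "u \<in> A"
        by (simp add: A_def)
      then show ?thesis
        using le by (auto simp: le_fun_def)
    qed
  qed
  then obtain m where m: "sublinear m" "\<And>x. m x \<le> p x" and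
    min: "\<And>a. a \<in> A \<Longrightarrow> a \<le> m \<Longrightarrow> a = m"
    by (auto simp: A_def)
  have "linear m"
    using m by (intro linear_of_minimal_sublinear min) (auto simp: A_def le_fun_def intro: order_trans)
  then show ?thesis
    using m(2) by (rule that)
qed

text \<open>A linear functional below \<open>slide p v\<close> does it: its value at
  \<open>- v\<close> is at most \<open>- p v\<close>, which forces equality at
  \<open>v\<close>.\<close>

lemma linear_supporting_sublinear:
  assumes p: "sublinear p"
  obtains f where "linear f" "\<And>x. f x \<le> p x" "f v = p v"
proof -
  obtain f where f: "linear f" "\<And>x. f x \<le> slide p v x"
    using linear_below_sublinear[OF sublinear_slide[OF p, of v]] by blast
  then have le: "f x \<le> p x" for x
    using slide_le_self[OF p, of v x] by (meson order_trans)
  have "f (- v) \<le> - p v"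
    using f(2)[of "- v"] slide_uminus[OF p, of v] by linarith
  then have "f v = p v"
    using le[of v] by (simp add: linear_neg[OF f(1)])
  then show ?thesis
    using f(1) le by (intro that)
qed

section \<open>Functionals vanishing on a finite-dimensional subspace\<close>

text \<open>The distance to a subspace is the seminorm pulled back from the quotient by it.\<close>

lemma sublinear_infdist:
  fixes S :: "'a::real_normed_vector set"
  assumes S: "subspace S"
  shows "sublinear (\<lambda>x. infdist x S)"
proof (rule sublinearI)
  have ne: "S \<noteq> {}" using S subspace_0 by blast
  have greatest: "b \<le> infdist x S" if "\<And>s. s \<in> S \<Longrightarrow> b \<le> norm (x - s)" for b x
    unfolding infdist_notempty[OF ne] using ne that by (intro cINF_greatest) (auto simp: dist_norm)
  have le: "infdist x S \<le> norm (x - s)" if "s \<in> S" for x s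
    using infdist_le[OF that, of x] by (simp add: dist_norm)
  show "infdist (x + y) S \<le> infdist x S + infdist y S" for x y
  proof -
    have *: "infdist (x + y) S \<le> norm (x - s) + norm (y - t)" if "s \<in> S" "t \<in> S" for s t
    proof -
      have "infdist (x + y) S \<le> norm (x + y - (s + t))"
        using S that by (intro le subspace_add)
      also have "\<dots> \<le> norm (x - s) + norm (y - t)"
        using norm_triangle_ineq[of "x - s" "y - t"] by (simp add: algebra_simps)
      finally show ?thesis .
    qed
    have "infdist (x + y) S - norm (x - s) \<le> infdist y S" if "s \<in> S" for s
      using *[OF that] by (intro greatest) (simp add: algebra_simps)
    then have "infdist (x + y) S - infdist y S \<le> infdist x S"
      by (intro greatest) (smt (verit))
    then show ?thesis by simp
  qed
  show "infdist 0 S = 0"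
    using S by (simp add: subspace_0)
  show "infdist (c *\<^sub>R x) S \<le> c * infdist x S" if c: "c > 0" for c x
  proof -
    have "infdist (c *\<^sub>R x) S / c \<le> infdist x S"
    proof (rule greatest)
      fix s assume "s \<in> S"
      then have "infdist (c *\<^sub>R x) S \<le> norm (c *\<^sub>R x - c *\<^sub>R s)"
        using S by (intro le subspace_scale)
      also have "\<dots> = c * norm (x - s)"
        using c by (simp flip: scaleR_diff_right)
      finally show "infdist (c *\<^sub>R x) S / c \<le> norm (x - s)"
        using c by (simp add: field_simps)
    qed
    then show ?thesis
      using c by (simp add: field_simps)
  qed
qed

text \<open>Supporting the distance at \<open>v\<close> gives everything at once: the distance is at
  most the norm and is zero on \<open>S\<close>, where applying the bound to \<open>s\<close> and
  \<open>- s\<close> yields \<open>f s = 0\<close>.\<close>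

lemma functional_attaining_infdist:
  fixes S :: "'a::real_normed_vector set"
  assumes S: "subspace S"
  obtains f where "linear f" "\<And>x. \<bar>f x\<bar> \<le> norm x" "\<And>s. s \<in> S \<Longrightarrow> f s = 0" "f v = infdist v S"
proof -
  obtain f where f: "linear f" "\<And>x. f x \<le> infdist x S" "f v = infdist v S"
    using linear_supporting_sublinear[OF sublinear_infdist[OF S], of v] by blast
  have le: "f x \<le> norm x" for x
    using f(2)[of x] infdist_le[OF subspace_0[OF S], of x] by simp
  have "\<bar>f x\<bar> \<le> norm x" for x
    using le[of x] le[of "- x"] by (simp add: linear_neg[OF f(1)])
  moreover have "f s = 0" if "s \<in> S" for s
    using f(2)[of s] f(2)[of "- s"] that subspace_neg[OF S that] by (simp add: linear_neg[OF f(1)])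
  ultimately show ?thesis
    using f(1,3) by (intro that)
qed

lemma bounded_linear_of_abs_le_norm:
  assumes "linear f" "\<And>x. \<bar>f x\<bar> \<le> norm x"
  shows "bounded_linear f"
  using assms by (intro bounded_linear.intro bounded_linear_axioms.intro exI[of _ 1]) auto

text \<open>Needed for a positive distance from the span to points outside it. Induction on the
  generators: closedness of the smaller span makes the distance functional nonzero at the new
  vector.\<close>

lemma closed_span_finite:
  fixes A :: "'a::real_normed_vector set"
  assumes "finite A"
  shows "closed (span A)"
  using assms
proof (induction A)
  case (insert v A)
  show ?case
  proof (cases "v \<in> span A")
    case True
    then show ?thesis
      using insert by (simp add: span_redundant)
  next
    case False
    obtain f where f: "linear f" "\<And>x. \<bar>f x\<bar> \<le> norm x" "\<And>s. s \<in> span A \<Longrightarrow> f s = 0"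
        and fv: "f v = infdist v (span A)"
      using functional_attaining_infdist[OF subspace_span, of A v] by blast
    have v: "f v > 0"
      unfolding fv using False insert(3) span_zero by (intro infdist_pos_not_in_closed) auto
    \<comment> \<open>The coordinate along \<open>v\<close> is \<open>f x / f v\<close>, so the span is a preimage of \<open>span A\<close> under a
      continuous map.\<close>
    have "span (insert v A) = {x. x - (f x / f v) *\<^sub>R v \<in> span A}"
    proof (intro set_eqI iffI; clarsimp simp: span_insert)
      fix x k assume k: "x - k *\<^sub>R v \<in> span A"
      from f(3)[OF this] have "f x = k * f v"
        by (simp add: linear_diff[OF f(1)] linear_scale[OF f(1)])
      then show "x - (f x / f v) *\<^sub>R v \<in> span A"
        using k v by simp
    qed auto
    moreover have "continuous_on UNIV (\<lambda>x. x - (f x / f v) *\<^sub>R v)"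
      using v by (intro continuous_intros linear_continuous_on
          bounded_linear_of_abs_le_norm f) auto
    then have "closed {x. x - (f x / f v) *\<^sub>R v \<in> span A}"
      using continuous_closed_vimage[OF insert(3), of "\<lambda>x. x - (f x / f v) *\<^sub>R v"]
      by (simp add: vimage_def continuous_on_eq_continuous_at)
    ultimately show ?thesis by simp
  qed
qed simp

text \<open>As in Riesz's lemma, \<open>y\<close> is the normalised difference of \<open>v\<close>
  and an almost nearest point of the span.\<close>

lemma functional_vanishing_on_finite:
  fixes A :: "'a::real_normed_vector set"
  assumes "finite A" "span A \<noteq> UNIV"
  obtains f y where "linear f" "\<And>x. \<bar>f x\<bar> \<le> norm x" "\<And>s. s \<in> A \<Longrightarrow> f s = 0"
    "norm y \<le> 1" "f y \<ge> 1 / 2"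
proof -
  obtain v where v: "v \<notin> span A" using assms(2) by blast
  obtain f where f: "linear f" "\<And>x. \<bar>f x\<bar> \<le> norm x" "\<And>s. s \<in> span A \<Longrightarrow> f s = 0"
      and fv: "f v = infdist v (span A)"
    using functional_attaining_infdist[OF subspace_span, of A v] by blast
  have ne: "span A \<noteq> {}" using span_zero by blast
  have pos: "infdist v (span A) > 0"
    using v ne closed_span_finite[OF assms(1)] by (intro infdist_pos_not_in_closed) auto
  \<comment> \<open>The infimum need not be attained; the factor 2 leaves room above it and is the
    source of the bound \<open>1 / 2\<close>.\<close>
  have "\<exists>s\<in>span A. dist v s < 2 * infdist v (span A)"
  proof (rule ccontr)
    assume "\<not> ?thesis"
    then have "2 * infdist v (span A) \<le> infdist v (span A)"
      unfolding infdist_notempty[OF ne] using ne by (intro cINF_greatest) (auto simp: not_less)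
    then show False using pos by simp
  qed
  then obtain s where s: "s \<in> span A" "norm (v - s) < 2 * infdist v (span A)"
    by (auto simp: dist_norm)
  have "v \<noteq> s" using s v by auto
  define y where "y = (1 / norm (v - s)) *\<^sub>R (v - s)"
  have fy: "f y = f v / norm (v - s)"
    by (simp add: y_def linear_scale[OF f(1)] linear_diff[OF f(1)] f(3)[OF s(1)])
  have "f y \<ge> 1 / 2"
    using s(2) \<open>v \<noteq> s\<close> unfolding fy fv by (simp add: pos_le_divide_eq)
  moreover have "norm y \<le> 1"
    using \<open>v \<noteq> s\<close> by (simp add: y_def)
  ultimately show ?thesis
    using f span_base by (intro that[of f y]) auto
qed

section \<open>Products of functionals as homogeneous polynomials\<close>

text \<open>The symmetric form is the average, over all permutations of the slots, of the product of
  the functionals.\<close>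

lemma hom_polys_prod:
  fixes f :: "nat \<Rightarrow> 'a::real_normed_vector \<Rightarrow> real"
  assumes f: "\<And>i. i < n \<Longrightarrow> bounded_linear (f i)"
  shows "(\<lambda>x. \<Prod>i<n. f i x) \<in> hom_polys n"
proof -
  define T where "T p x = (\<Prod>k<n. f (p k) (x k))" for p :: "nat \<Rightarrow> nat" and x :: "nat \<Rightarrow> 'a"
  define M where "M x = (\<Sum>p | p permutes {..<n}. T p x) / fact n" for x
  have fp: "bounded_linear (f (p k))" if "p permutes {..<n}" "k < n" for p k
    using f permutes_in_image[OF that(1), of k] that(2) by simp
  have "n_linear n M"
    unfolding n_linear_def
  proof (intro ballI allI impI)
    fix x :: "nat \<Rightarrow> 'a" and i assume i: "i < n"
    \<comment> \<open>Only the factor of slot \<open>i\<close> depends on \<open>t\<close>, so each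
      summand is a functional times a constant.\<close>
    have T: "T p (x(i := t)) = f (p i) t * (\<Prod>k\<in>{..<n} - {i}. f (p k) (x k))" for p t
      unfolding T_def using i by (subst prod.remove[of _ i]) (auto intro!: prod.cong)
    have "linear (\<lambda>t. T p (x(i := t)))" if "p permutes {..<n}" for p
      unfolding T using bounded_linear.linear[OF fp[OF that i]]
      by (auto simp: linear_iff algebra_simps)
    then have "linear (\<lambda>t. \<Sum>p | p permutes {..<n}. T p (x(i := t)))"
      by (intro linear_compose_sum) auto
    then show "linear (\<lambda>t. M (x(i := t)))"
      unfolding M_def by (auto simp: linear_iff add_divide_distrib)
  qed
  moreover have "n_symmetric n M"
    unfolding n_symmetric_def
  proof (intro ballI allI impI)
    fix x :: "nat \<Rightarrow> 'a" and q assume q: "q permutes {..<n}"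
    \<comment> \<open>Permuting the arguments by \<open>q\<close> is absorbed by the reindexing
      \<open>p \<circ> q\<close> of the sum over all permutations.\<close>
    have "T (p \<circ> q) (x \<circ> q) = T p x" for p
      unfolding T_def using prod.permute[OF q, of "\<lambda>k. f (p k) (x k)"] by (simp add: o_def)
    then show "M (x \<circ> q) = M x"
      unfolding M_def by (subst sum_permutations_compose_right[OF q]) simp
  qed
  moreover have "n_continuous n M"
    unfolding n_continuous_def M_def T_def
  proof (intro continuous_map_real_divide continuous_map_sum continuous_map_prod)
    fix p k assume "p \<in> {p. p permutes {..<n}}" "k \<in> {..<n}"
    then have "continuous_map euclidean euclideanreal (f (p k))"
      using linear_continuous_on[OF fp, of p k UNIV] by simp
    with \<open>k \<in> {..<n}\<close> show "continuous_map (product_topology (\<lambda>_. euclidean) {..<n}) euclideanreal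
        (\<lambda>x. f (p k) (x k))"
      using continuous_map_compose[OF continuous_map_product_projection, of k "{..<n}" "\<lambda>_. euclidean"
          euclideanreal "f (p k)"]
      by (auto simp: o_def)
  qed (auto simp: finite_permutations)
  moreover have "(\<Prod>i<n. f i x) = M (diag n x)" for x
  proof -
    have "T p (diag n x) = (\<Prod>i<n. f i x)" if "p permutes {..<n}" for p
      unfolding T_def diag_def using prod.permute[OF that, of "\<lambda>k. f k x"] by (simp add: o_def)
    then show ?thesis
      by (simp add: M_def card_permutations[of _ n])
  qed
  ultimately show ?thesis
    unfolding hom_polys_def is_sym_form_def by blast
qed

lemma hom_polys_diff:
  assumes "P \<in> hom_polys n" "Q \<in> hom_polys n"
  shows "(\<lambda>x. P x - Q x) \<in> hom_polys n"
proof -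
  obtain M N where "is_sym_form n P M" "is_sym_form n Q N"
    using assms by (auto simp: hom_polys_def)
  then have "is_sym_form n (\<lambda>x. P x - Q x) (\<lambda>x. M x - N x)"
    unfolding is_sym_form_def n_linear_def n_symmetric_def n_continuous_def
    by (auto intro!: linear_compose_sub continuous_map_diff)
  then show ?thesis
    by (auto simp: hom_polys_def)
qed

lemma hom_polys_mult_powers:
  assumes "bounded_linear f" "bounded_linear g" "k \<le> n"
  shows "(\<lambda>x. f x ^ (n - k) * g x ^ k) \<in> hom_polys n"
proof -
  have "(\<lambda>x. \<Prod>i<n. (if i < k then g else f) x) \<in> hom_polys n"
    using assms by (intro hom_polys_prod) auto
  moreover have "(\<Prod>i<n. (if i < k then g else f) x) = f x ^ (n - k) * g x ^ k" for x
  proof -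
    have "{..<n} = {..<k} \<union> {k..<n}" using assms(3) by auto
    then show ?thesis
      by (simp add: prod.union_disjoint ivl_disj_int)
  qed
  ultimately show ?thesis by simp
qed

lemma poly_norm_ge:
  assumes P: "P \<in> hom_polys n" "n > 0" and x: "norm x \<le> 1"
  shows "\<bar>P x\<bar> \<le> poly_norm P"
proof -
  obtain B where B: "B \<ge> 0" "\<And>x. \<bar>P x\<bar> \<le> B * norm x ^ n"
    using hom_poly_bound[OF P] by blast
  have "\<bar>P z\<bar> \<le> B" if "z \<in> cball 0 1" for z
    using B(2)[of z] that mult_left_mono[OF power_le_one[of "norm z" n] B(1)] by simp
  then have "bdd_above ((\<lambda>x. \<bar>P x\<bar>) ` cball 0 1)"
    by (intro bdd_aboveI2)
  then show ?thesis
    unfolding poly_norm_def using x by (intro cSUP_upper) auto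
qed

lemma poly_norm_eq_1:
  assumes P: "P \<in> hom_polys n" "n > 0" and le: "\<And>x. \<bar>P x\<bar> \<le> norm x ^ n"
    and x: "norm x \<le> 1" "P x = 1"
  shows "poly_norm P = 1"
proof (rule antisym)
  show "poly_norm P \<le> 1"
    unfolding poly_norm_def
    by (rule cSUP_least) (auto intro: order_trans[OF le power_le_one])
  show "1 \<le> poly_norm P"
    using poly_norm_ge[OF P x(1)] x(2) by simp
qed

section \<open>Weak-star limits of bounded families\<close>

lemma proj_norm_0: "proj_norm n ((\<lambda>_. 0) :: 'a::real_normed_vector tensor) = 0"
  and zero_sym_tensor: "((\<lambda>_. 0) :: 'a tensor) \<in> sym_tensors n"
proof -
  have 0: "((\<lambda>_. 0) :: 'a tensor) = tensor_comb n 0 c x" for c x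
    by (simp add: tensor_comb_def fun_eq_iff)
  then show "((\<lambda>_. 0) :: 'a tensor) \<in> sym_tensors n"
    unfolding sym_tensors_def by blast
  let ?S = "{(\<Sum>j<m. \<bar>c j\<bar> * norm (x j) ^ n) |m c x. ((\<lambda>_. 0) :: 'a tensor) = tensor_comb n m c x}"
  have "0 \<in> ?S"
    using 0 by (intro CollectI exI[of _ 0]) auto
  moreover have "0 \<le> s" if "s \<in> ?S" for s
    using that by (auto intro!: sum_nonneg)
  ultimately show "proj_norm n ((\<lambda>_. 0) :: 'a tensor) = 0"
    unfolding proj_norm_def by (rule cInf_eq_minimum)
qed

lemma sym_predual_nonempty: "sym_predual n \<noteq> ({} :: (nat \<Rightarrow> 'a::real_normed_vector tensor) set set)"
proof -
  have "(\<lambda>_. (\<lambda>_. 0) :: 'a tensor) \<in> tensor_cauchy n"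
    by (simp add: tensor_cauchy_def zero_sym_tensor proj_norm_0 fun_diff_def)
  then show ?thesis
    unfolding sym_predual_def by (auto simp: quotient_def)
qed

text \<open>On bounded sets pointwise convergence implies weak-star convergence: an element of the
  completion is approximated by a finite tensor, on which the pairing is a finite combination of
  point values, and the three errors are at most \<open>e / 3\<close> each.\<close>

lemma poly_pairing_tendsto_of_pointwise:
  fixes P :: "'a::real_normed_vector \<Rightarrow> real"
  assumes n: "n > 0" and P: "P \<in> hom_polys n" "\<And>x. \<bar>P x\<bar> \<le> norm x ^ n"
    and F: "\<forall>\<^sub>F Q in F. Q \<in> hom_polys n \<and> (\<forall>x. \<bar>Q x\<bar> \<le> norm x ^ n)"
    and lim: "\<And>x. ((\<lambda>Q. Q x) \<longlongrightarrow> P x) F"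
    and C: "C \<in> sym_predual n"
  shows "((\<lambda>Q. poly_pairing n Q C) \<longlongrightarrow> poly_pairing n P C) F"
proof (rule tendstoI)
  fix e :: real assume e: "e > 0"
  obtain u where u: "u \<in> C" "u \<in> tensor_cauchy n"
  proof -
    obtain w where w: "w \<in> tensor_cauchy n" "C = tensor_equiv n `` {w}"
      using C by (auto simp: sym_predual_def quotient_def)
    have "(w, w) \<in> tensor_equiv n"
      using w(1) by (simp add: tensor_equiv_def fun_diff_def proj_norm_0)
    then show ?thesis
      using w by (intro that[of w]) auto
  qed
  have ut: "u k \<in> sym_tensors n" for k
    using u by (simp add: tensor_cauchy_def)
  have "e / 3 > 0" using e by simp
  then obtain K where K: "\<And>k l. k \<ge> K \<Longrightarrow> l \<ge> K \<Longrightarrow> proj_norm n (u k - u l) < e / 3"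
    using u(2) unfolding tensor_cauchy_def by blast
  \<comment> \<open>The index \<open>K\<close> does not depend on \<open>Q\<close>, because every
    such \<open>Q\<close> satisfies the growth bound with constant 1.\<close>
  have approx: "\<bar>poly_pairing n Q C - poly_apply n Q (u K)\<bar> \<le> e / 3"
    if Q: "Q \<in> hom_polys n" "\<And>x. \<bar>Q x\<bar> \<le> norm x ^ n" for Q
  proof (rule LIMSEQ_le_const2)
    show "(\<lambda>k. \<bar>poly_apply n Q (u k) - poly_apply n Q (u K)\<bar>)
        \<longlonglongrightarrow> \<bar>poly_pairing n Q C - poly_apply n Q (u K)\<bar>"
      by (intro tendsto_intros poly_pairing_tendsto[OF Q(1) n C u(1)])
    have "\<bar>poly_apply n Q (u k - u K)\<bar> \<le> 1 * proj_norm n (u k - u K)" for k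
      using Q by (intro proj_norm_bound sym_tensors_diff ut) auto
    then have "\<bar>poly_apply n Q (u k) - poly_apply n Q (u K)\<bar> \<le> e / 3" if "k \<ge> K" for k
      using K[OF that order_refl] by (smt (verit) fun_diff_def poly_apply_def)
    then show "\<exists>N. \<forall>k\<ge>N. \<bar>poly_apply n Q (u k) - poly_apply n Q (u K)\<bar> \<le> e / 3"
      by blast
  qed
  obtain m c x where uK: "u K = tensor_comb n m c x"
    using ut[of K] by (auto simp: sym_tensors_def)
  have "((\<lambda>Q. \<Sum>j<m. c j * Q (x j)) \<longlongrightarrow> (\<Sum>j<m. c j * P (x j))) F"
    by (intro tendsto_intros lim)
  then have "\<forall>\<^sub>F Q in F. \<bar>(\<Sum>j<m. c j * Q (x j)) - (\<Sum>j<m. c j * P (x j))\<bar> < e / 3"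
    using \<open>e / 3 > 0\<close> unfolding tendsto_iff dist_real_def by blast
  then show "\<forall>\<^sub>F Q in F. dist (poly_pairing n Q C) (poly_pairing n P C) < e"
    using F
  proof eventually_elim
    case (elim Q)
    then show ?case
      using approx[of Q] approx[OF P]
        abs_triangle_ineq[of "poly_pairing n Q C - (\<Sum>j<m. c j * Q (x j))"
          "(\<Sum>j<m. c j * Q (x j)) - poly_pairing n P C"]
        abs_triangle_ineq[of "(\<Sum>j<m. c j * Q (x j)) - (\<Sum>j<m. c j * P (x j))"
          "(\<Sum>j<m. c j * P (x j)) - poly_pairing n P C"]
      by (simp add: poly_apply_tensor_comb P(1) uK dist_real_def abs_minus_commute)
  qed
qed

text \<open>The sets that eventually contain the filter whenever they contain \<open>x\<close> are
  closed under finite intersections and unions, so it is enough to treat the generating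
  sets.\<close>

lemma limitin_weak_star_of_pairing:
  assumes "x \<in> V" "E \<noteq> {}" and V: "\<forall>\<^sub>F y in F. y \<in> V"
    and lim: "\<And>e. e \<in> E \<Longrightarrow> ((\<lambda>y. pair y e) \<longlongrightarrow> pair x e) F"
  shows "limitin (weak_star_topology V E pair) (\<lambda>y. y) x F"
  unfolding limitin_def
proof (intro conjI allI impI)
  obtain e where "e \<in> E" using assms(2) by blast
  \<comment> \<open>With \<open>U = UNIV\<close> a single predual element exhibits \<open>V\<close>
    as a generating set, so \<open>x\<close> lies in the topological space.\<close>
  then have "V \<in> {{v \<in> V. pair v e \<in> U} |e U. e \<in> E \<and> open U}"
    by (intro CollectI exI[of _ e] exI[of _ UNIV]) auto
  then show "x \<in> topspace (weak_star_topology V E pair)"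
    using assms(1) unfolding weak_star_topology_def topology_generated_by_topspace by blast
  fix U assume U: "openin (weak_star_topology V E pair) U \<and> x \<in> U"
  then have "generate_topology_on {{v \<in> V. pair v e \<in> U} |e U. e \<in> E \<and> open U} U"
    unfolding weak_star_topology_def by (simp add: openin_topology_generated_by_iff)
  then have "x \<in> U \<longrightarrow> (\<forall>\<^sub>F y in F. y \<in> U)"
  proof induction
    case (UN K)
    then show ?case
      by (blast intro: eventually_mono)
  next
    case (Basis S)
    then obtain e W where "e \<in> E" "open W" and S: "S = {v \<in> V. pair v e \<in> W}"
      by blast
    then have "\<forall>\<^sub>F y in F. pair y e \<in> W" if "x \<in> S"
      using lim[of e] that by (auto dest: topological_tendstoD)
    with V show ?case
      unfolding S by (auto elim: eventually_elim2)
  qed (auto intro: eventually_conj)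
  with U show "\<forall>\<^sub>F y in F. y \<in> U" by blast
qed

section \<open>Perturbations of \<open>f ^ n\<close> that violate the Kadec--Klee property\<close>

theorem theorem5p3:
  fixes n :: nat
  assumes infinite_dimensional: "\<nexists>B :: 'a::banach set. finite B \<and> span B = UNIV"
    and n: "n \<ge> 2"
  shows "\<not> weak_star_KK (hom_polys n :: ('a \<Rightarrow> real) set) poly_norm (sym_predual n) (poly_pairing n)"
proof
  assume KK: "weak_star_KK (hom_polys n :: ('a \<Rightarrow> real) set) poly_norm (sym_predual n) (poly_pairing n)"
  have n0: "n > 0" using n by simp
  obtain v :: 'a where "v \<noteq> 0"
    using infinite_dimensional[simplified, rule_format, of "{}"] by auto
  define a where "a = (1 / norm v) *\<^sub>R v"
  have a: "norm a = 1"
    using \<open>v \<noteq> 0\<close> by (simp add: a_def)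
  \<comment> \<open>The distance from \<open>a\<close> to the zero subspace is
    \<open>norm a\<close>, so this is a norming functional.\<close>
  obtain f where f: "linear f" "\<And>x. \<bar>f x\<bar> \<le> norm x" and fa: "f a = 1"
    using functional_attaining_infdist[OF subspace_single_0, of a] a by (auto simp: infdist_def)
  have fb: "bounded_linear f"
    using f by (rule bounded_linear_of_abs_le_norm)
  define P where "P x = f x ^ n" for x
  have P: "P \<in> hom_polys n"
    using hom_polys_mult_powers[OF fb fb, of 0 n] by (simp add: P_def[abs_def])
  have Ple: "\<bar>P x\<bar> \<le> norm x ^ n" for x
    by (simp add: P_def power_abs power_mono f)
  have PN: "poly_norm P = 1"
    using a fa by (intro poly_norm_eq_1[OF P n0 Ple, of a]) (auto simp: P_def)
  \<comment> \<open>A lower bound for \<open>R\<close> at the point \<open>z\<close> chosen below,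
    where \<open>f z\<close> is at least \<open>1 / 2\<close> and the absolute value of
    \<open>g z\<close> at least \<open>1 / 4\<close>.\<close>
  define c :: real where "c = (1 / 2) ^ (n - 2) * (1 / 4)\<^sup>2"
  have "\<exists>Q \<in> hom_polys n. (\<forall>x. \<bar>Q x\<bar> \<le> norm x ^ n) \<and> (\<forall>x\<in>insert a A. Q x = P x) \<and>
      c \<le> poly_norm (Q - P)" if finA: "finite A" for A
  proof -
    have "span (insert a A) \<noteq> UNIV"
      using infinite_dimensional finA by blast
    then obtain g y where g: "linear g" "\<And>x. \<bar>g x\<bar> \<le> norm x" "\<And>s. s \<in> insert a A \<Longrightarrow> g s = 0"
      and y: "norm y \<le> 1" "g y \<ge> 1 / 2"
      using functional_vanishing_on_finite[of "insert a A"] finA by blast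
    have gb: "bounded_linear g"
      using g(1,2) by (rule bounded_linear_of_abs_le_norm)
    define R where "R x = f x ^ (n - 2) * (g x)\<^sup>2" for x
    have R: "R \<in> hom_polys n"
      using hom_polys_mult_powers[OF fb gb n] by (simp add: R_def[abs_def])
    define Q where "Q = (\<lambda>x. P x - R x)"
    have Q: "Q \<in> hom_polys n"
      unfolding Q_def by (intro hom_polys_diff P R)
    have pow: "z ^ n = z ^ (n - 2) * z\<^sup>2" for z :: real
      using n by (metis le_add_diff_inverse2 power_add)
    have "\<bar>Q x\<bar> \<le> norm x ^ n" for x
    proof -
      have sq: "(f x)\<^sup>2 \<le> (norm x)\<^sup>2" "(g x)\<^sup>2 \<le> (norm x)\<^sup>2"
        using f(2) g(2) by (simp_all add: abs_le_square_iff[symmetric])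
      have "Q x = f x ^ (n - 2) * ((f x)\<^sup>2 - (g x)\<^sup>2)"
        by (simp add: Q_def P_def R_def pow algebra_simps)
      then have "\<bar>Q x\<bar> = \<bar>f x\<bar> ^ (n - 2) * \<bar>(f x)\<^sup>2 - (g x)\<^sup>2\<bar>"
        by (simp add: abs_mult power_abs)
      also have "\<dots> \<le> norm x ^ (n - 2) * (norm x)\<^sup>2"
        using sq zero_le_power2[of "f x"] zero_le_power2[of "g x"]
        by (intro mult_mono power_mono f abs_leI) (linarith | simp)+
      finally show ?thesis by (simp add: pow)
    qed
    moreover have "Q x = P x" if "x \<in> insert a A" for x
      using g(3)[OF that] by (simp add: Q_def R_def)
    moreover have "c \<le> poly_norm (Q - P)"
    proof -
      \<comment> \<open>The sign \<open>s\<close> keeps \<open>f\<close> from dropping below \<open>f a = 1\<close>; since \<open>g a = 0\<close>, it does not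
        affect \<open>\<bar>g\<bar>\<close>.\<close>
      define s where "s = (if f y \<ge> 0 then 1 else - 1 :: real)"
      \<comment> \<open>The midpoint stays in the unit ball and keeps half of \<open>f a = 1\<close>
        and half of the size of \<open>g y\<close>, so neither factor of \<open>R\<close> is small
        there.\<close>
      define z where "z = (1 / 2) *\<^sub>R (a + s *\<^sub>R y)"
      have s: "\<bar>s\<bar> = 1" "s * f y \<ge> 0"
        by (auto simp: s_def)
      have "norm (a + s *\<^sub>R y) \<le> 2"
        using norm_triangle_ineq[of a "s *\<^sub>R y"] a y(1) s(1) by simp
      then have z: "norm z \<le> 1"
        by (simp add: z_def)
      have "f z = (1 + s * f y) / 2" "g z = s * g y / 2"
        using fa g(3)[of a] by (simp_all add: z_def linear_add[OF f(1)] linear_scale[OF f(1)]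
            linear_add[OF g(1)] linear_scale[OF g(1)])
      then have "f z \<ge> 1 / 2" "\<bar>g z\<bar> = \<bar>g y\<bar> / 2"
        using s by (simp, metis abs_divide abs_mult abs_numeral mult_1)
      then have "f z \<ge> 1 / 2" "\<bar>g z\<bar> \<ge> 1 / 4"
        using y(2) by auto
      then have "c \<le> f z ^ (n - 2) * \<bar>g z\<bar>\<^sup>2"
        unfolding c_def by (intro mult_mono power_mono) auto
      also have "\<dots> = R z"
        by (simp add: R_def)
      also have "\<dots> \<le> \<bar>(Q - P) z\<bar>"
        by (simp add: Q_def)
      also have "\<dots> \<le> poly_norm (Q - P)"
        using hom_polys_diff[OF Q P] z n0 by (intro poly_norm_ge[of _ n]) (auto simp: fun_diff_def)
      finally show ?thesis .
    qed
    ultimately show ?thesis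
      using Q by blast
  qed
  then obtain Q where Q: "\<And>A. finite A \<Longrightarrow> Q A \<in> hom_polys n"
    "\<And>A x. finite A \<Longrightarrow> \<bar>Q A x\<bar> \<le> norm x ^ n"
    "\<And>A x. finite A \<Longrightarrow> x \<in> insert a A \<Longrightarrow> Q A x = P x"
    "\<And>A. finite A \<Longrightarrow> c \<le> poly_norm (Q A - P)"
    by metis
  \<comment> \<open>Finite sets are directed by inclusion. Once \<open>A\<close> contains
    \<open>x\<close>, \<open>Q A\<close> agrees with \<open>P\<close> at \<open>x\<close>, so each
    evaluation is eventually constant.\<close>
  define F where "F = filtermap Q (finite_subsets_at_top UNIV)"
  have F_I: "eventually S F" if "\<And>A. finite A \<Longrightarrow> S (Q A)" for S
    unfolding F_def eventually_filtermap using that by (intro eventually_finite_subsets_at_top_weakI)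
  \<comment> \<open>Agreement with \<open>P\<close> at \<open>a\<close> means that the value 1 is
    attained there.\<close>
  have QN: "poly_norm (Q A) = 1" if "finite A" for A
    using a fa Q(1-3)[OF that] by (intro poly_norm_eq_1[OF _ n0, of _ a]) (auto simp: P_def)
  have lim: "((\<lambda>R. R x) \<longlongrightarrow> P x) F" for x
  proof (rule tendsto_eventually)
    show "\<forall>\<^sub>F R in F. R x = P x"
      unfolding F_def eventually_filtermap eventually_finite_subsets_at_top
      using Q(3) by (intro exI[of _ "{x}"]) auto
  qed
  have "limitin (weak_star_topology (hom_polys n) (sym_predual n) (poly_pairing n)) (\<lambda>y. y) P F"
  proof (rule limitin_weak_star_of_pairing)
    show "sym_predual n \<noteq> ({} :: (nat \<Rightarrow> 'a tensor) set set)"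
      by (rule sym_predual_nonempty)
    show "((\<lambda>R. poly_pairing n R C) \<longlongrightarrow> poly_pairing n P C) F" if "C \<in> sym_predual n" for C
      using Q(1,2) by (intro poly_pairing_tendsto_of_pointwise n0 P Ple lim that F_I) auto
  qed (use P Q(1) F_I in auto)
  moreover have "\<forall>\<^sub>F R in F. R \<in> hom_polys n \<and> poly_norm R = 1"
    using Q(1) QN by (intro F_I) auto
  ultimately have "((\<lambda>R. poly_norm (R - P)) \<longlongrightarrow> 0) F"
    using KK P PN unfolding weak_star_KK_def by blast
  moreover have "F \<noteq> bot"
    by (simp add: F_def filtermap_bot_iff)
  ultimately have "c \<le> 0"
    using Q(4) by (intro tendsto_lowerbound[where F = F]) (auto intro: F_I)
  moreover have "c > 0"
    unfolding c_def by simp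
  ultimately show False by simp
qed

end
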